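(* Let $G$ be a finite group and let $(S,T)$ be an $(s,t)$-$\lambda$-fold near-factorization of $G$. Then $(S,T)$ is equivalent to a symmetric $(s,t)$-$\lambda$-fold near-factorization of $G$ if and only if $(S,T)$ is translate-equivalent to a symmetric $(s,t)$-$\lambda$-fold near-factorization of $G$.
   Context: For subsets $S,T$ of a finite group $G$ with identity $e$, and a positive integer $\lambda$, $(S,T)$ is a $\lambda$-fold near-factorization of $G$ if every non-identity element $g\in G$ can be written as $g=xy$ with $x\in S$, $y\in T$ in exactly $\lambda$ ways, and $xy\neq e$ for all $x\in S$, $y\in T$. It is an $(s,t)$-$\lambda$-fold near-factorization if moreover $|S|=s$ and $|T|=t$. A subset $A\subseteq G$ is symmetric if $A=\{a^{-1}:a\in A\}$; a near-factorization $(S,T)$ is symmetric if both $S$ and $T$ are symmetric. Two subsets $A,B\subseteq G$ are equivalent if there exist $f\in\mathrm{Aut}(G)$ and $g\in G$ such that $B=g f(A)$ (left equivalence); this is the same relation as the existence of $f\in\mathrm{Aut}(G)$ and $g\in G$ with $B=f(A)g$ (right equivalence), and it is symmetric in $A,B$. Two $(s,t)$-$\lambda$-fold near-factorizations $(S,T)$ and $(S',T')$ of $G$ are equivalent if $S$ is equivalent to $S'$ and $T$ is equivalent to $T'$ (with possibly different $f,g$ for the two pairs). They are translate-equivalent if there is $g\in G$ with $S'=Sg$ and $T'=g^{-1}T$. *)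

theory Defs
  imports "HOL-Algebra.Algebra"
begin

definition near_factorization ::
  "('a, 'b) monoid_scheme \<Rightarrow> nat \<Rightarrow> 'a set \<Rightarrow> 'a set \<Rightarrow> bool"
where
  "near_factorization G l S T \<longleftrightarrow>
     0 < l \<and> S \<subseteq> carrier G \<and> T \<subseteq> carrier G \<and>
     (\<forall>g \<in> carrier G - {\<one>\<^bsub>G\<^esub>}.
        card {(x, y). x \<in> S \<and> y \<in> T \<and> x \<otimes>\<^bsub>G\<^esub> y = g} = l) \<and>
     (\<forall>x \<in> S. \<forall>y \<in> T. x \<otimes>\<^bsub>G\<^esub> y \<noteq> \<one>\<^bsub>G\<^esub>)"

definition st_near_factorization ::
  "('a, 'b) monoid_scheme \<Rightarrow> nat \<Rightarrow> nat \<Rightarrow> nat \<Rightarrow> 'a set \<Rightarrow> 'a set \<Rightarrow> bool"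
where
  "st_near_factorization G s t l S T \<longleftrightarrow>
     near_factorization G l S T \<and> card S = s \<and> card T = t"

definition symmetric_subset :: "('a, 'b) monoid_scheme \<Rightarrow> 'a set \<Rightarrow> bool" where
  "symmetric_subset G A \<longleftrightarrow> A = {inv\<^bsub>G\<^esub> a | a. a \<in> A}"

definition symmetric_pair :: "('a, 'b) monoid_scheme \<Rightarrow> 'a set \<Rightarrow> 'a set \<Rightarrow> bool" where
  "symmetric_pair G S T \<longleftrightarrow> symmetric_subset G S \<and> symmetric_subset G T"

text \<open>\<^term>\<open>iso G G\<close> serves as the automorphism group of \<open>G\<close>: its members are determined only on
  \<^term>\<open>carrier G\<close>, which is all that matters for images of subsets of the carrier.\<close>

definition equivalent_subsets ::
  "('a, 'b) monoid_scheme \<Rightarrow> 'a set \<Rightarrow> 'a set \<Rightarrow> bool"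
where
  "equivalent_subsets G A B \<longleftrightarrow>
     (\<exists>f \<in> iso G G. \<exists>g \<in> carrier G. B = g <#\<^bsub>G\<^esub> (f ` A))"

definition equivalent_pairs ::
  "('a, 'b) monoid_scheme \<Rightarrow> 'a set \<Rightarrow> 'a set \<Rightarrow> 'a set \<Rightarrow> 'a set \<Rightarrow> bool"
where
  "equivalent_pairs G S T S' T' \<longleftrightarrow>
     equivalent_subsets G S S' \<and> equivalent_subsets G T T'"

definition translate_equivalent_pairs ::
  "('a, 'b) monoid_scheme \<Rightarrow> 'a set \<Rightarrow> 'a set \<Rightarrow> 'a set \<Rightarrow> 'a set \<Rightarrow> bool"
where
  "translate_equivalent_pairs G S T S' T' \<longleftrightarrow>
     (\<exists>g \<in> carrier G. S' = S #>\<^bsub>G\<^esub> g \<and> T' = (inv\<^bsub>G\<^esub> g) <#\<^bsub>G\<^esub> T)"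

end

theory Submission
  imports Defs
begin

text \<open>
  Translate-equivalence always yields equivalence, since a right translate is a left translate of a
  conjugate. Conversely, if \<open>S\<close> is equivalent to a symmetric set, then some right translate \<open>A = Sc\<close>
  is symmetric; put \<open>C = c\<^sup>-\<^sup>1T\<close>, so that \<open>(A, C)\<close> is a near-factorization. Inverting everything,
  \<open>(C\<^sup>-\<^sup>1, A)\<close> is one too. In the group ring this reads \<open>A C = \<lambda>(G - e) = C\<^sup>-\<^sup>1 A\<close>, and evaluating
  \<open>C\<^sup>-\<^sup>1 A C\<close> by associativity in two ways gives \<open>\<lambda>(|C| G - C) = \<lambda>(|C| G - C\<^sup>-\<^sup>1)\<close>, so \<open>C\<close> is
  symmetric.
\<close>

section \<open>Counting factorizations as group-ring coefficients\<close>

text \<open>The left side is the coefficient of \<open>h\<close> in the group-ring product of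
  \<open>S\<close> and \<open>T\<close>. Writing the count as a double sum, with the identity
  included, lets it be substituted into triple sums.\<close>

lemma near_factorization_sum:
  assumes "finite (carrier G)" "near_factorization G l S T" "h \<in> carrier G"
  shows "(\<Sum>x\<in>S. \<Sum>y\<in>T. of_bool (x \<otimes>\<^bsub>G\<^esub> y = h)) = (if h = \<one>\<^bsub>G\<^esub> then 0 else l)"
proof -
  have fin: "finite S" "finite T"
    using assms finite_subset unfolding near_factorization_def by blast+
  have "(\<Sum>x\<in>S. \<Sum>y\<in>T. of_bool (x \<otimes>\<^bsub>G\<^esub> y = h)) =
      (\<Sum>p\<in>S \<times> T. of_bool (fst p \<otimes>\<^bsub>G\<^esub> snd p = h) :: nat)"
    by (simp add: sum.cartesian_product case_prod_beta)
  also have "\<dots> = card ((S \<times> T) \<inter> {p. fst p \<otimes>\<^bsub>G\<^esub> snd p = h})"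
    using fin by simp
  also have "(S \<times> T) \<inter> {p. fst p \<otimes>\<^bsub>G\<^esub> snd p = h} =
      {(x, y). x \<in> S \<and> y \<in> T \<and> x \<otimes>\<^bsub>G\<^esub> y = h}"
    by auto
  also have "card \<dots> = (if h = \<one>\<^bsub>G\<^esub> then 0 else l)"
  proof (cases "h = \<one>\<^bsub>G\<^esub>")
    case True
    then have "{(x, y). x \<in> S \<and> y \<in> T \<and> x \<otimes>\<^bsub>G\<^esub> y = h} = {}"
      using assms(2) unfolding near_factorization_def by blast
    then show ?thesis using True by (simp only: card.empty simp_thms if_True)
  qed (use assms in \<open>simp add: near_factorization_def\<close>)
  finally show ?thesis .
qed

text \<open>This is the coefficient of \<open>g\<close> in \<lambda>(|A| G - A), with \<lambda> =
  \<open>l\<close>.\<close>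

lemma sum_if_eq_card_Diff:
  assumes "finite A"
  shows "(\<Sum>x\<in>A. if x = g then 0 else l) = l * card (A - {g})"
proof -
  have "(\<Sum>x\<in>A. if x = g then 0 else l) = (\<Sum>x\<in>A - {g}. l)"
    using assms by (intro sum.mono_neutral_cong_right) auto
  then show ?thesis by simp
qed

context group
begin

lemma mult_inv_mult_cancel:
  assumes "x \<in> carrier G" "y \<in> carrier G"
  shows "x \<otimes> (inv x \<otimes> y) = y" "inv x \<otimes> (x \<otimes> y) = y"
  using assms by (simp_all flip: m_assoc)

text \<open>A left and a right cofactor of \<open>S\<close> of equal size coincide, by associativity
  of the group-ring product U S T. It will be applied with \<open>U\<close> the set of inverses of
  \<open>T\<close>.\<close>

lemma near_factorization_unique_factor:
  assumes fin: "finite (carrier G)"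
    and ST: "near_factorization G l S T" and US: "near_factorization G l U S"
    and card: "card U = card T"
  shows "U = T"
proof -
  have sub: "S \<subseteq> carrier G" "T \<subseteq> carrier G" "U \<subseteq> carrier G" and l: "0 < l"
    using ST US unfolding near_factorization_def by auto
  have finTU: "finite T" "finite U"
    using sub fin finite_subset by blast+
  have "g \<in> U \<longleftrightarrow> g \<in> T" if g: "g \<in> carrier G" for g
  proof -
    \<comment> \<open>\<open>N\<close> is the coefficient of \<open>g\<close> in U S T. It is
      evaluated first by fixing \<open>x\<close> and collapsing S T, then by fixing \<open>z\<close>
      and collapsing U S.\<close>
    define N :: nat
      where "N = (\<Sum>x\<in>U. \<Sum>y\<in>S. \<Sum>z\<in>T. of_bool (x \<otimes> y \<otimes> z = g))"
    have "N = (\<Sum>x\<in>U. \<Sum>y\<in>S. \<Sum>z\<in>T. of_bool (y \<otimes> z = inv x \<otimes> g))"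
      unfolding N_def
    proof (intro sum.cong refl arg_cong[where f = of_bool])
      fix x y z assume "x \<in> U" "y \<in> S" "z \<in> T"
      then have "x \<in> carrier G" "y \<in> carrier G" "z \<in> carrier G" using sub by auto
      then show "(x \<otimes> y \<otimes> z = g) = (y \<otimes> z = inv x \<otimes> g)"
        using g by (metis inv_solve_left m_assoc m_closed)
    qed
    also have "\<dots> = (\<Sum>x\<in>U. if inv x \<otimes> g = \<one> then 0 else l)"
      using sub g by (intro sum.cong refl near_factorization_sum[OF fin ST]) auto
    also have "\<dots> = (\<Sum>x\<in>U. if x = g then 0 else l)"
    proof (intro sum.cong refl)
      fix x assume "x \<in> U"
      then have "x \<in> carrier G" using sub by auto
      then have "inv x \<otimes> g = \<one> \<longleftrightarrow> x = g"
        using g by (metis inv_solve_left r_one one_closed)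
      then show "(if inv x \<otimes> g = \<one> then 0 else l) = (if x = g then 0 else l)" by simp
    qed
    finally have N1: "N = l * card (U - {g})"
      using sum_if_eq_card_Diff[OF finTU(2)] by simp
    \<comment> \<open>Second evaluation: two swaps move the sum over \<open>T\<close>
      outermost.\<close>
    have "N = (\<Sum>x\<in>U. \<Sum>z\<in>T. \<Sum>y\<in>S. of_bool (x \<otimes> y \<otimes> z = g))"
      unfolding N_def by (intro sum.cong refl sum.swap)
    also have "\<dots> = (\<Sum>z\<in>T. \<Sum>x\<in>U. \<Sum>y\<in>S. of_bool (x \<otimes> y \<otimes> z = g))"
      by (rule sum.swap)
    also have "\<dots> = (\<Sum>z\<in>T. \<Sum>x\<in>U. \<Sum>y\<in>S. of_bool (x \<otimes> y = g \<otimes> inv z))"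
    proof (intro sum.cong refl arg_cong[where f = of_bool])
      fix x y z assume "x \<in> U" "y \<in> S" "z \<in> T"
      then have "x \<in> carrier G" "y \<in> carrier G" "z \<in> carrier G" using sub by auto
      then show "(x \<otimes> y \<otimes> z = g) = (x \<otimes> y = g \<otimes> inv z)"
        using g by (metis inv_solve_right m_closed)
    qed
    also have "\<dots> = (\<Sum>z\<in>T. if g \<otimes> inv z = \<one> then 0 else l)"
      using sub g by (intro sum.cong refl near_factorization_sum[OF fin US]) auto
    also have "\<dots> = (\<Sum>z\<in>T. if z = g then 0 else l)"
    proof (intro sum.cong refl)
      fix z assume "z \<in> T"
      then have "z \<in> carrier G" using sub by auto
      then have "g \<otimes> inv z = \<one> \<longleftrightarrow> z = g"
        using g by (metis inv_solve_right l_one one_closed)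
      then show "(if g \<otimes> inv z = \<one> then 0 else l) = (if z = g then 0 else l)" by simp
    qed
    finally have "N = l * card (T - {g})"
      using sum_if_eq_card_Diff[OF finTU(1)] by simp
    with N1 l have eq: "card (U - {g}) = card (T - {g})" by simp
    \<comment> \<open>Removing \<open>g\<close> lowers the cardinality exactly when \<open>g\<close>
      is a member, so equal sizes before and after removal give equal membership.\<close>
    show ?thesis
      using eq card finTU
      by (metis Diff_empty Diff_insert0 card_Diff1_less less_irrefl)
  qed
  then show ?thesis using sub by blast
qed

section \<open>Inversion and translation of near-factorizations\<close>

text \<open>Inversion reverses products, so factorizations of \<open>inv g\<close> over (S, T)
  correspond to factorizations of \<open>g\<close> over the inverted sets in the opposite
  order.\<close>

lemma near_factorization_inv:
  assumes "near_factorization G l S T"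
  shows "near_factorization G l (m_inv G ` T) (m_inv G ` S)"
proof -
  have sub: "S \<subseteq> carrier G" "T \<subseteq> carrier G" and l: "0 < l"
    and cnt: "\<And>g. g \<in> carrier G - {\<one>} \<Longrightarrow> card {(x, y). x \<in> S \<and> y \<in> T \<and> x \<otimes> y = g} = l"
    and ne: "\<And>x y. x \<in> S \<Longrightarrow> y \<in> T \<Longrightarrow> x \<otimes> y \<noteq> \<one>"
    using assms unfolding near_factorization_def by auto
  have "card {(x, y). x \<in> m_inv G ` T \<and> y \<in> m_inv G ` S \<and> x \<otimes> y = g} = l"
    if g: "g \<in> carrier G - {\<one>}" for g
  proof -
    have "bij_betw (\<lambda>(x, y). (inv y, inv x))
        {(x, y). x \<in> S \<and> y \<in> T \<and> x \<otimes> y = inv g}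
        {(x, y). x \<in> m_inv G ` T \<and> y \<in> m_inv G ` S \<and> x \<otimes> y = g}"
    \<comment> \<open>The map is its own inverse on pairs from the carrier; cases 3 and 4 are the
      two image inclusions.\<close>
    proof (rule bij_betw_byWitness[where f' = "\<lambda>(x, y). (inv y, inv x)"], goal_cases)
      case 3
      have "inv y \<otimes> inv x = g" if "x \<in> S" "y \<in> T" "x \<otimes> y = inv g" for x y
      proof -
        have "inv y \<otimes> inv x = inv (x \<otimes> y)"
          using that(1,2) sub by (simp add: inv_mult_group subset_iff)
        then show ?thesis using that(3) g by simp
      qed
      then show ?case by auto
    next
      case 4
      have "x \<otimes> y = inv (inv y \<otimes> inv x)" if "x \<in> S" "y \<in> T" for x y
        using that sub by (simp add: inv_mult_group subset_iff)
      then show ?case using sub by (auto simp: subset_iff)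
    qed (use sub in \<open>auto simp: subset_iff\<close>)
    from bij_betw_same_card[OF this] show ?thesis using cnt[of "inv g"] g by simp
  qed
  moreover have "inv y \<otimes> inv x \<noteq> \<one>" if "x \<in> S" "y \<in> T" for x y
    using ne[OF that] that sub by (metis inv_eq_1_iff inv_mult_group m_closed subsetD)
  ultimately show ?thesis
    using l sub unfolding near_factorization_def by auto
qed

text \<open>The factors \<open>c\<close> and \<open>inv c\<close> cancel in the middle, so every
  product is unchanged.\<close>

lemma near_factorization_translate:
  assumes "near_factorization G l S T" and c: "c \<in> carrier G"
  shows "near_factorization G l (S #> c) (inv c <# T)"
proof -
  have sub: "S \<subseteq> carrier G" "T \<subseteq> carrier G" and l: "0 < l"
    and cnt: "\<And>g. g \<in> carrier G - {\<one>} \<Longrightarrow> card {(x, y). x \<in> S \<and> y \<in> T \<and> x \<otimes> y = g} = l"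
    and ne: "\<And>x y. x \<in> S \<Longrightarrow> y \<in> T \<Longrightarrow> x \<otimes> y \<noteq> \<one>"
    using assms unfolding near_factorization_def by auto
  have cancel: "(x \<otimes> c) \<otimes> (inv c \<otimes> y) = x \<otimes> y" if "x \<in> S" "y \<in> T" for x y
  proof -
    have "x \<in> carrier G" "y \<in> carrier G" using that sub by auto
    then show ?thesis using c by (simp add: mult_inv_mult_cancel m_assoc)
  qed
  have "card {(x, y). x \<in> S #> c \<and> y \<in> inv c <# T \<and> x \<otimes> y = g} = l"
    if g: "g \<in> carrier G - {\<one>}" for g
  proof -
    have "bij_betw (\<lambda>(x, y). (x \<otimes> c, inv c \<otimes> y))
        {(x, y). x \<in> S \<and> y \<in> T \<and> x \<otimes> y = g}
        {(x, y). x \<in> S #> c \<and> y \<in> inv c <# T \<and> x \<otimes> y = g}"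
      unfolding bij_betw_def
    proof
      show "inj_on (\<lambda>(x, y). (x \<otimes> c, inv c \<otimes> y)) {(x, y). x \<in> S \<and> y \<in> T \<and> x \<otimes> y = g}"
        using sub c by (auto simp: inj_on_def subset_iff)
      show "(\<lambda>(x, y). (x \<otimes> c, inv c \<otimes> y)) ` {(x, y). x \<in> S \<and> y \<in> T \<and> x \<otimes> y = g} =
        {(x, y). x \<in> S #> c \<and> y \<in> inv c <# T \<and> x \<otimes> y = g}"
        using cancel by (force simp: r_coset_def l_coset_def)
    qed
    from bij_betw_same_card[OF this] show ?thesis using cnt[OF g] by simp
  qed
  moreover have "\<forall>x\<in>S #> c. \<forall>y\<in>inv c <# T. x \<otimes> y \<noteq> \<one>"
    using ne cancel by (auto simp: r_coset_def l_coset_def)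
  ultimately show ?thesis
    using l sub c by (auto simp: near_factorization_def r_coset_subset_G l_coset_subset_G)
qed

section \<open>Symmetric sets and symmetric translates\<close>

text \<open>One inclusion suffices because inversion is an involution on the carrier.\<close>

lemma symmetric_subsetI:
  assumes sub: "A \<subseteq> carrier G" and "\<And>a. a \<in> A \<Longrightarrow> inv a \<in> A"
  shows "symmetric_subset G A"
  unfolding symmetric_subset_def using assms by (force simp: subset_iff)

text \<open>With \<open>c = f\<^sup>-\<^sup>1(g)\<close>, both \<open>cS\<close> and its conjugate \<open>Sc = c\<^sup>-\<^sup>1(cS)c\<close> are symmetric.\<close>

lemma symmetric_translate_if_equivalent:
  assumes "equivalent_subsets G S S'" "symmetric_subset G S'" and S: "S \<subseteq> carrier G"
  obtains c where "c \<in> carrier G" "symmetric_subset G (S #> c)"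
proof -
  obtain f g where f: "f \<in> iso G G" and g: "g \<in> carrier G" and S': "S' = g <# (f ` S)"
    using assms unfolding equivalent_subsets_def by blast
  have bij: "bij_betw f (carrier G) (carrier G)" and hom: "f \<in> hom G G"
    using f by (auto simp: iso_def)
  interpret f: group_hom G G f
    using hom by unfold_locales
  obtain c where c: "c \<in> carrier G" "f c = g"
    using bij g by (metis bij_betw_imp_surj_on imageE)
  have "inv (x \<otimes> c) \<in> S #> c" if x: "x \<in> S" for x
  proof -
    have xG: "x \<in> carrier G" using x S by auto
    \<comment> \<open>Since \<open>f c = g\<close>, the image of \<open>c \<otimes> x\<close> is
      \<open>g \<otimes> f x\<close>. Symmetry of \<open>S'\<close> then pulls back along the
      injective \<open>f\<close> to closure of cS under inversion.\<close>
    have "f (c \<otimes> x) \<in> S'" using x c xG S' by (auto simp: l_coset_def)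
    then have "inv (f (c \<otimes> x)) \<in> S'" using assms(2) unfolding symmetric_subset_def by blast
    then obtain y where y: "y \<in> S" "inv (f (c \<otimes> x)) = g \<otimes> f y"
      using S' by (auto simp: l_coset_def)
    have yG: "y \<in> carrier G" using y S by auto
    have "f (inv (c \<otimes> x)) = f (c \<otimes> y)" using y c xG yG by simp
    then have "inv (c \<otimes> x) = c \<otimes> y"
      using bij c xG yG by (meson bij_betw_imp_inj_on inj_onD inv_closed m_closed)
    then have "inv x \<otimes> inv c = c \<otimes> y" using c xG by (simp add: inv_mult_group)
    \<comment> \<open>This form is balanced between left and right: cancelling \<open>c\<close> on
      the left moves the symmetry from cS to Sc.\<close>
    then have "inv x = c \<otimes> y \<otimes> c" using c xG yG by (metis inv_closed inv_solve_right' m_closed)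
    then have "inv (x \<otimes> c) = y \<otimes> c"
      using c xG yG by (simp add: inv_mult_group m_assoc inv_solve_left')
    then show ?thesis using y by (auto simp: r_coset_def)
  qed
  then have "symmetric_subset G (S #> c)"
    using S c by (intro symmetric_subsetI r_coset_subset_G) (auto simp: r_coset_def)
  with c that show ?thesis by blast
qed

text \<open>Inverting (S, T) makes the set of inverses of \<open>T\<close> a left cofactor of
  \<open>S\<close>, while \<open>T\<close> is a right cofactor of the same size; uniqueness
  identifies them.\<close>

lemma symmetric_cofactor:
  assumes "finite (carrier G)" "near_factorization G l S T" "symmetric_subset G S"
  shows "symmetric_subset G T"
proof -
  have "m_inv G ` S = S"
    using assms(3) by (auto simp: symmetric_subset_def)
  then have "near_factorization G l (m_inv G ` T) S"
    using near_factorization_inv[OF assms(2)] by simp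
  moreover have "card (m_inv G ` T) = card T"
    using assms(2) by (intro card_image) (auto simp: near_factorization_def inj_on_def subset_iff)
  ultimately have "m_inv G ` T = T"
    using near_factorization_unique_factor assms by blast
  then show ?thesis by (auto simp: symmetric_subset_def)
qed

section \<open>Translates as equivalent subsets\<close>

lemma equivalent_subsets_l_coset:
  assumes "A \<subseteq> carrier G" "c \<in> carrier G"
  shows "equivalent_subsets G A (c <# A)"
proof -
  have "(\<lambda>x. x) \<in> iso G G" by (auto simp: iso_def hom_def bij_betw_def)
  then show ?thesis using assms unfolding equivalent_subsets_def by force
qed

text \<open>Equivalence is defined through left translates, so the inner automorphism
  \<open>?f\<close> is needed to write Ac as c(c^-1 A c).\<close>

lemma equivalent_subsets_r_coset:
  assumes A: "A \<subseteq> carrier G" and c: "c \<in> carrier G"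
  shows "equivalent_subsets G A (A #> c)"
proof -
  let ?f = "\<lambda>x. inv c \<otimes> x \<otimes> c"
  have conj: "c \<otimes> (inv c \<otimes> x \<otimes> c) = x \<otimes> c" if "x \<in> carrier G" for x
    using that c by (simp add: m_assoc mult_inv_mult_cancel)
  have conj': "inv c \<otimes> (c \<otimes> x \<otimes> inv c) \<otimes> c = x" if "x \<in> carrier G" for x
    using that c by (simp add: m_assoc mult_inv_mult_cancel)
  have "?f \<in> hom G G"
  proof (rule homI)
    fix x y assume "x \<in> carrier G" "y \<in> carrier G"
    then show "?f (x \<otimes> y) = ?f x \<otimes> ?f y"
      using c conj[of y] by (simp add: m_assoc)
  qed (use c in auto)
  moreover have "bij_betw ?f (carrier G) (carrier G)"
    unfolding bij_betw_def
  proof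
    show "inj_on ?f (carrier G)" using c by (auto simp: inj_on_def)
    show "?f ` carrier G = carrier G"
    proof
      show "carrier G \<subseteq> ?f ` carrier G"
      proof
        fix x assume "x \<in> carrier G"
        then show "x \<in> ?f ` carrier G"
          using c conj'[of x] by (intro image_eqI[of _ _ "c \<otimes> x \<otimes> inv c"]) auto
      qed
    qed (use c in auto)
  qed
  ultimately have "?f \<in> iso G G" by (simp add: iso_def)
  moreover have "A #> c = c <# (?f ` A)"
    using conj A by (force simp: r_coset_def l_coset_def subset_iff)
  ultimately show ?thesis using c unfolding equivalent_subsets_def by blast
qed

lemma st_near_factorization_translate:
  assumes "st_near_factorization G s t l S T" and c: "c \<in> carrier G"
  shows "st_near_factorization G s t l (S #> c) (inv c <# T)"
proof -
  have "near_factorization G l S T" and card: "card S = s" "card T = t"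
    using assms unfolding st_near_factorization_def by auto
  then have sub: "S \<subseteq> carrier G" "T \<subseteq> carrier G"
    unfolding near_factorization_def by auto
  have "card ((\<lambda>x. x \<otimes> c) ` S) = card S" "card ((\<lambda>y. inv c \<otimes> y) ` T) = card T"
    using sub c by (auto intro!: card_image simp: inj_on_def subset_iff)
  moreover have "S #> c = (\<lambda>x. x \<otimes> c) ` S" "inv c <# T = (\<lambda>y. inv c \<otimes> y) ` T"
    by (auto simp: r_coset_def l_coset_def)
  ultimately show ?thesis
    using near_factorization_translate[OF \<open>near_factorization G l S T\<close> c] card
    by (simp add: st_near_factorization_def)
qed

end

theorem theorem1p14:
  fixes G :: "('a, 'b) monoid_scheme"
    and S T :: "'a set"
    and s t l :: nat
  assumes "group G"
    and "finite (carrier G)"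
    and "st_near_factorization G s t l S T"
  shows
    "(\<exists>S' T'. st_near_factorization G s t l S' T' \<and> symmetric_pair G S' T' \<and>
        equivalent_pairs G S T S' T') \<longleftrightarrow>
     (\<exists>S' T'. st_near_factorization G s t l S' T' \<and> symmetric_pair G S' T' \<and>
        translate_equivalent_pairs G S T S' T')"
proof
  interpret group G by fact
  have sub: "S \<subseteq> carrier G" "T \<subseteq> carrier G"
    using assms(3) unfolding st_near_factorization_def near_factorization_def by auto
  {
    assume "\<exists>S' T'. st_near_factorization G s t l S' T' \<and> symmetric_pair G S' T' \<and>
        equivalent_pairs G S T S' T'"
    then obtain S' where "equivalent_subsets G S S'" "symmetric_subset G S'"
      unfolding symmetric_pair_def equivalent_pairs_def by blast
    then obtain c where c: "c \<in> carrier G" and sym: "symmetric_subset G (S #>\<^bsub>G\<^esub> c)"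
      using symmetric_translate_if_equivalent sub(1) by blast
    have nf: "st_near_factorization G s t l (S #>\<^bsub>G\<^esub> c) (inv\<^bsub>G\<^esub> c <#\<^bsub>G\<^esub> T)"
      using st_near_factorization_translate[OF assms(3) c] .
    \<comment> \<open>The element \<open>c\<close> was chosen to make the first factor symmetric;
      the second factor inherits symmetry as its cofactor.\<close>
    then have "symmetric_subset G (inv\<^bsub>G\<^esub> c <#\<^bsub>G\<^esub> T)"
      using symmetric_cofactor assms(2) sym unfolding st_near_factorization_def by blast
    with nf sym c show "\<exists>S' T'. st_near_factorization G s t l S' T' \<and> symmetric_pair G S' T' \<and>
        translate_equivalent_pairs G S T S' T'"
      unfolding symmetric_pair_def translate_equivalent_pairs_def by blast
  next
    assume "\<exists>S' T'. st_near_factorization G s t l S' T' \<and> symmetric_pair G S' T' \<and>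
        translate_equivalent_pairs G S T S' T'"
    then show "\<exists>S' T'. st_near_factorization G s t l S' T' \<and> symmetric_pair G S' T' \<and>
        equivalent_pairs G S T S' T'"
      \<comment> \<open>The two components may use different automorphisms: a conjugation for the
        right translate of \<open>S\<close>, the identity for the left translate of
        \<open>T\<close>.\<close>
      unfolding translate_equivalent_pairs_def equivalent_pairs_def
      using equivalent_subsets_r_coset[OF sub(1)] equivalent_subsets_l_coset[OF sub(2)]
      by (metis inv_closed)
  }
qed

end
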